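(* Let $X$ be a cut space and let $U\subseteq X$ be a saturated subset. Then $U$ with the subspace topology is a cut space.
   Context: For a topological space $X$, the specialization preorder is $x\le y$ iff $x\in\mathrm{cl}\{y\}$; all order-theoretic notions in $X$ refer to it (for a subspace, to the specialization preorder of the subspace, with bounds taken inside the subspace). For $A\subseteq X$, $A^{\uparrow}$ and $A^{\downarrow}$ denote the sets of all upper, respectively lower, bounds of $A$ in $X$, and $A^{\delta}=(A^{\uparrow})^{\downarrow}$ is the cut closure of $A$. Directed sets are nonempty. $X$ is a cut space if $\mathrm{cl}\,D=D^{\delta}$ for every directed subset $D$ of $X$. A subset is saturated if it is an intersection of open sets, equivalently an upper set for the specialization preorder. *)

theory Defs
  imports "HOL-Analysis.Abstract_Topology"
begin

definition spec_le :: "'a topology \<Rightarrow> 'a \<Rightarrow> 'a \<Rightarrow> bool" where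
  "spec_le X x y \<longleftrightarrow> x \<in> topspace X \<and> y \<in> topspace X \<and> x \<in> X closure_of {y}"

definition upper_bounds :: "'a topology \<Rightarrow> 'a set \<Rightarrow> 'a set" where
  "upper_bounds X A = {u \<in> topspace X. \<forall>a\<in>A. spec_le X a u}"

definition lower_bounds :: "'a topology \<Rightarrow> 'a set \<Rightarrow> 'a set" where
  "lower_bounds X A = {l \<in> topspace X. \<forall>a\<in>A. spec_le X l a}"

definition cut_closure :: "'a topology \<Rightarrow> 'a set \<Rightarrow> 'a set" where
  "cut_closure X A = lower_bounds X (upper_bounds X A)"

definition directed_in :: "'a topology \<Rightarrow> 'a set \<Rightarrow> bool" where
  "directed_in X D \<longleftrightarrow> D \<subseteq> topspace X \<and> D \<noteq> {} \<and>
     (\<forall>a\<in>D. \<forall>b\<in>D. \<exists>c\<in>D. spec_le X a c \<and> spec_le X b c)"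

definition cut_space :: "'a topology \<Rightarrow> bool" where
  "cut_space X \<longleftrightarrow> (\<forall>D. directed_in X D \<longrightarrow> X closure_of D = cut_closure X D)"

text \<open>
  The intersection is taken inside the space, so that the empty family yields
  \<^term>\<open>topspace X\<close> rather than \<^term>\<open>UNIV\<close>.
\<close>
definition saturated_in :: "'a topology \<Rightarrow> 'a set \<Rightarrow> bool" where
  "saturated_in X U \<longleftrightarrow> (\<exists>\<U>. (\<forall>V\<in>\<U>. openin X V) \<and> U = topspace X \<inter> \<Inter>\<U>)"

end

theory Submission
  imports Defs
begin

text \<open>A saturated \<open>U\<close> is an upper set, so a nonempty \<open>D\<close> inside
  \<open>U\<close> has the same upper bounds in \<open>U\<close> as in \<open>X\<close>; only the
  lower bounds of these are cut down to \<open>U\<close>. Hence the cut closure in \<open>U\<close>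
  is the trace on \<open>U\<close> of that in \<open>X\<close>
  (\<open>cut_closure_subtopology_saturated\<close>). Closures restrict in the same way, so the
  equality in \<open>X\<close> restricts to \<open>U\<close>.\<close>

text \<open>If \<open>a\<close> lies in the closure of \<open>{u}\<close>, every open set containing
  \<open>a\<close> contains \<open>u\<close>; this passes to intersections.\<close>

lemma saturated_in_upward_closed:
  assumes "saturated_in X U" "a \<in> U" "spec_le X a u"
  shows "u \<in> U"
  using assms unfolding saturated_in_def spec_le_def in_closure_of by blast

lemma spec_le_subtopology:
  "spec_le (subtopology X U) x y \<longleftrightarrow> x \<in> U \<and> y \<in> U \<and> spec_le X x y"
  by (auto simp: spec_le_def closure_of_subtopology)

lemma directed_in_subtopologyD:
  assumes "directed_in (subtopology X U) D"
  shows "directed_in X D" "D \<subseteq> U" "D \<noteq> {}"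
  using assms by (auto simp: directed_in_def spec_le_subtopology) blast

text \<open>
  Nonemptiness is essential: in \<^term>\<open>X\<close> every point bounds the empty set from above.
\<close>
lemma upper_bounds_subtopology_saturated:
  assumes "saturated_in X U" "A \<subseteq> U" "A \<noteq> {}"
  shows "upper_bounds (subtopology X U) A = upper_bounds X A"
  using assms saturated_in_upward_closed[OF assms(1)]
  by (fastforce simp: upper_bounds_def spec_le_subtopology)

lemma lower_bounds_subtopology:
  assumes "A \<subseteq> U"
  shows "lower_bounds (subtopology X U) A = U \<inter> lower_bounds X A"
  using assms by (auto simp: lower_bounds_def spec_le_subtopology)

lemma cut_closure_subtopology_saturated:
  assumes "saturated_in X U" "A \<subseteq> U" "A \<noteq> {}"
  shows "cut_closure (subtopology X U) A = U \<inter> cut_closure X A"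
proof -
  \<comment> \<open>Needed because \<open>lower_bounds_subtopology\<close> applies only to subsets
    of \<open>U\<close>.\<close>
  have "upper_bounds X A \<subseteq> U"
    using upper_bounds_subtopology_saturated[OF assms] by (auto simp: upper_bounds_def)
  then show ?thesis
    by (simp add: cut_closure_def upper_bounds_subtopology_saturated[OF assms]
        lower_bounds_subtopology)
qed

theorem proposition3p2:
  fixes X :: "'a topology" and U :: "'a set"
  assumes "cut_space X"
    and "saturated_in X U"
  shows "cut_space (subtopology X U)"
  unfolding cut_space_def
proof (intro allI impI)
  fix D assume "directed_in (subtopology X U) D"
  note D = directed_in_subtopologyD[OF this]
  have "subtopology X U closure_of D = U \<inter> X closure_of D"
    using D(2) by (simp add: closure_of_subtopology Int_absorb1)
  \<comment> \<open>The order of \<open>U\<close> is the restricted one, so \<open>D\<close> is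
    directed in \<open>X\<close> too.\<close>
  also have "\<dots> = U \<inter> cut_closure X D"
    using assms(1) D(1) by (simp add: cut_space_def)
  also have "\<dots> = cut_closure (subtopology X U) D"
    using cut_closure_subtopology_saturated[OF assms(2) D(2,3)] by simp
  finally show "subtopology X U closure_of D = cut_closure (subtopology X U) D" .
qed

end
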